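(* Let $I\subset\mathbb{R}$ be an open interval, $n\in\mathbb{N}$, $\alpha\in\,]-1,+\infty[$ and $f\in C^{n+2}(I)$. Then $$\forall x\in I_h,\quad D^{(n)}_{h,\alpha,\alpha}f(x)=f^{(n)}(x)+O(h^2)$$ (as $h\to0^+$). Moreover, if there exists $M_{n+2}>0$ such that $|f^{(n+2)}(x)|\le M_{n+2}$ for any $x\in I$, then $$\left\|D^{(n)}_{h,\alpha,\alpha}f(x)-f^{(n)}(x)\right\|_\infty\le \hat C_1h^2,\qquad \hat C_1=\frac{M_{n+2}}{(n+2)!}\int_{-1}^{1}\left|t^{n+2}\rho_{n,\alpha,\alpha}(t)\right|dt.$$
   Context: $\mathbb{N}$ includes $0$. For $h>0$, $I_h:=\{x\in I:\ [x-h,x+h]\subset I\}$, and $\|\cdot\|_\infty$ denotes the supremum over $x\in I_h$. For $\alpha,\beta>-1$: $P_n^{(\alpha,\beta)}(t)=\sum_{j=0}^{n}\binom{n+\alpha}{j}\binom{n+\beta}{n-j}\left(\frac{t-1}{2}\right)^{n-j}\left(\frac{t+1}{2}\right)^{j}$ is the $n$-th Jacobi polynomial, $w_{\alpha,\beta}(t)=(1-t)^{\alpha}(1+t)^{\beta}$, $B(a,b)=\Gamma(a)\Gamma(b)/\Gamma(a+b)$, $$\rho_{n,\alpha,\beta}(t)=\frac{2^{-(n+\alpha+\beta+1)}\,n!}{B(n+\alpha+1,n+\beta+1)}P_n^{(\alpha,\beta)}(t)\,w_{\alpha,\beta}(t),$$ and the minimal estimator is $D^{(n)}_{h,\alpha,\beta}f(x)=\frac{1}{h^{n}}\int_{-1}^{1}\rho_{n,\alpha,\beta}(t)f(x+ht)\,dt$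 for $x\in I_h$. *)

theory Defs
  imports "HOL-Analysis.Analysis" "HOL-Library.Landau_Symbols"
begin

(* Meant for open S, where the two-sided derivatives taken by deriv at points of S
   depend only on the restriction of f to S. *)
definition C_k_on :: "nat \<Rightarrow> (real \<Rightarrow> real) \<Rightarrow> real set \<Rightarrow> bool" where
  "C_k_on k f S \<longleftrightarrow>
     (\<forall>j<k. \<forall>x\<in>S. (deriv ^^ j) f field_differentiable (at x)) \<and>
     continuous_on S ((deriv ^^ k) f)"

definition inner_domain :: "real set \<Rightarrow> real \<Rightarrow> real set" where
  "inner_domain I h = {x \<in> I. {x - h..x + h} \<subseteq> I}"

(* Values in ennreal: the supremum is \<infinity> if g is unbounded on S, and 0 if S is empty. *)
definition sup_norm_on :: "real set \<Rightarrow> (real \<Rightarrow> real) \<Rightarrow> ennreal" where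
  "sup_norm_on S g = (SUP x\<in>S. ennreal \<bar>g x\<bar>)"

definition jacobi_poly :: "nat \<Rightarrow> real \<Rightarrow> real \<Rightarrow> real \<Rightarrow> real" where
  "jacobi_poly n \<alpha> \<beta> t =
     (\<Sum>j=0..n. ((real n + \<alpha>) gchoose j) * ((real n + \<beta>) gchoose (n - j)) *
        ((t - 1) / 2) ^ (n - j) * ((t + 1) / 2) ^ j)"

(* At t = 1 and t = -1 the value is 0, because 0 powr a = 0 for every a (including a = 0);
   the weight is only used under integrals over [-1,1], where these two points do not matter. *)
definition jacobi_weight :: "real \<Rightarrow> real \<Rightarrow> real \<Rightarrow> real" where
  "jacobi_weight \<alpha> \<beta> t = (1 - t) powr \<alpha> * (1 + t) powr \<beta>"

definition jacobi_density :: "nat \<Rightarrow> real \<Rightarrow> real \<Rightarrow> real \<Rightarrow> real" where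
  "jacobi_density n \<alpha> \<beta> t =
     2 powr (- (real n + \<alpha> + \<beta> + 1)) * fact n / Beta (real n + \<alpha> + 1) (real n + \<beta> + 1) *
     jacobi_poly n \<alpha> \<beta> t * jacobi_weight \<alpha> \<beta> t"

(* Meaningful for h > 0 and x in inner_domain I h, where I is the domain of f. *)
definition minimal_estimator ::
    "nat \<Rightarrow> real \<Rightarrow> real \<Rightarrow> real \<Rightarrow> (real \<Rightarrow> real) \<Rightarrow> real \<Rightarrow> real" where
  "minimal_estimator n h \<alpha> \<beta> f x =
     1 / h ^ n * (LINT t:{-1..1}|lborel. jacobi_density n \<alpha> \<beta> t * f (x + h * t))"

end

theory Submission
  imports Defs
begin

text \<open>
  Write \<open>\<rho>\<close> for the density of the estimator. The estimator integrates \<open>f (x + h * t)\<close> against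
  \<open>\<rho> t\<close>, so everything depends on the moments of \<open>\<rho>\<close>: those of order \<open>k < n\<close> vanish and the one
  of order \<open>n\<close> is \<open>n!\<close> (\<open>jacobi_density_moment\<close>), so that the Taylor polynomial of degree \<open>n\<close> is
  sent exactly to the \<open>n\<close>-th derivative. When both parameters agree, \<open>\<rho>\<close> has the parity of \<open>n\<close>,
  hence the moment of order \<open>n + 1\<close> vanishes as well (\<open>ultraspherical_density_moment_Suc\<close>). This
  gains one order: the error is the integral of \<open>\<rho>\<close> against the Taylor remainder of order \<open>n + 2\<close>,
  which the Lagrange form bounds by \<open>M / (n+2)! * \<bar>h * t\<bar> ^ (n + 2)\<close>, and dividing by \<open>h ^ n\<close>
  leaves \<open>h\<^sup>2\<close> (\<open>ultraspherical_estimator_error\<close>). The uniform estimate is a supremum of these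
  bounds; the local one uses that the derivative of order \<open>n + 2\<close> is bounded near \<open>x\<close> by
  continuity.

  The moments come from neither the Rodrigues formula nor integration by parts. In the powers of
  \<open>1 + t\<close> every summand of the Jacobi polynomial gives a Beta integral, and after cancelling Gamma
  factors the \<open>k\<close>-th moment is a constant times the \<open>n\<close>-th finite difference of
  \<open>j \<mapsto> pochhammer (j + \<beta> + 1) k\<close>, a monic polynomial of degree \<open>k\<close> in \<open>j\<close>: it is zero for
  \<open>k < n\<close> and, up to sign, \<open>n!\<close> for \<open>k = n\<close>.
\<close>

section \<open>Beta integrals on \<open>[-1, 1]\<close>\<close>

text \<open>
  Euler's Beta integral after the substitution \<open>s = (1 + t) / 2\<close>.
\<close>

lemma has_bochner_integral_beta_weight:
  fixes a b :: real
  assumes a: "a > -1" and b: "b > -1"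
  shows "has_bochner_integral lborel
           (\<lambda>t. indicator {-1..1} t *\<^sub>R ((1 - t) powr a * (1 + t) powr b))
           (2 powr (a + b + 1) * Beta (a + 1) (b + 1))"
proof -
  define g :: "real \<Rightarrow> real" where
    "g s = indicator {0..1} s * (s powr b * (1 - s) powr a)" for s
  have nonneg: "g s \<ge> 0" for s
    by (simp add: g_def)
  have meas: "g \<in> borel_measurable borel"
    unfolding g_def by measurable
  have "((\<lambda>s. s powr b * (1 - s) powr a) has_integral Beta (b + 1) (a + 1)) {0..1}"
    using has_integral_Beta_real[of "b + 1" "a + 1"] a b by simp
  moreover have "g = (\<lambda>s. if s \<in> {0..1} then s powr b * (1 - s) powr a else 0)"
    by (auto simp: g_def)
  ultimately have "(g has_integral Beta (a + 1) (b + 1)) UNIV"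
    by (simp only: has_integral_restrict_UNIV Beta_commute)
  then have nn: "integral\<^sup>N lborel g = Beta (a + 1) (b + 1)"
    by (intro nn_integral_has_integral_lborel meas nonneg)
  have Beta0: "Beta (a + 1) (b + 1) \<ge> 0"
    using a b by (simp add: Beta_def Gamma_real_nonneg)
  have "has_bochner_integral lborel g (Beta (a + 1) (b + 1))"
    using meas nonneg nn Beta0 by (intro has_bochner_integral_nn_integral) auto
  then have "has_bochner_integral lborel (\<lambda>t. g (1/2 + 1/2 * t)) (2 * Beta (a + 1) (b + 1))"
    using lborel_integrable_real_affine[of g "1/2" "1/2"]
      lborel_integral_real_affine[of "1/2" g "1/2"]
    by (simp add: has_bochner_integral_iff)
  then have "has_bochner_integral lborel (\<lambda>t. 2 powr (a + b) * g (1/2 + 1/2 * t))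
      (2 powr (a + b) * (2 * Beta (a + 1) (b + 1)))"
    by (rule has_bochner_integral_mult_right)
  moreover have "2 powr (a + b) * g (1/2 + 1/2 * t) =
      indicator {-1..1} t *\<^sub>R ((1 - t) powr a * (1 + t) powr b)" for t
  proof (cases "t \<in> {-1..1}")
    case True
    have "1/2 + 1/2 * t = (1 + t) / 2" "1 - (1 + t) / 2 = (1 - t) / 2"
      by (simp_all add: field_simps)
    then show ?thesis
      using True unfolding g_def by (simp only:) (simp add: powr_divide powr_add)
  qed (auto simp: g_def indicator_def)
  ultimately show ?thesis
    by (simp add: powr_add mult_ac)
qed

section \<open>Finite differences of Pochhammer polynomials\<close>

text \<open>
  Up to sign, the left-hand sum is the finite difference of \<open>g\<close> of order \<open>Suc n\<close> at \<open>0\<close>; Pascal's rule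
  turns it into the difference of order \<open>n\<close> of the first difference of \<open>g\<close>.
\<close>

lemma alternating_binomial_sum_Suc:
  fixes g :: "nat \<Rightarrow> 'a :: comm_ring_1"
  shows "(\<Sum>j\<le>Suc n. (-1) ^ j * of_nat (Suc n choose j) * g j) =
         (\<Sum>j\<le>n. (-1) ^ j * of_nat (n choose j) * (g j - g (Suc j)))"
proof -
  have "(\<Sum>j\<le>Suc n. (-1) ^ j * of_nat (Suc n choose j) * g j) =
      g 0 + (\<Sum>j\<le>n. (-1) ^ Suc j * of_nat (Suc n choose Suc j) * g (Suc j))"
    by (subst sum.atMost_Suc_shift) simp
  also have "(\<Sum>j\<le>n. (-1) ^ Suc j * of_nat (Suc n choose Suc j) * g (Suc j)) =
      (\<Sum>j\<le>n. (-1) ^ Suc j * of_nat (n choose Suc j) * g (Suc j)) -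
      (\<Sum>j\<le>n. (-1) ^ j * of_nat (n choose j) * g (Suc j))"
    by (simp add: algebra_simps sum_subtractf sum_negf sum.distrib)
  also have "g 0 + \<dots> = (\<Sum>j\<le>Suc n. (-1) ^ j * of_nat (n choose j) * g j) -
      (\<Sum>j\<le>n. (-1) ^ j * of_nat (n choose j) * g (Suc j))"
    by (subst sum.atMost_Suc_shift) simp
  also have "(\<Sum>j\<le>Suc n. (-1) ^ j * of_nat (n choose j) * g j) =
      (\<Sum>j\<le>n. (-1) ^ j * of_nat (n choose j) * g j)"
    by (simp add: binomial_eq_0)
  finally show ?thesis
    by (simp only: sum_subtractf right_diff_distrib)
qed

text \<open>
  The Pochhammer symbol behaves under differences as a power does under differentiation: a first
  difference lowers the degree \<open>k\<close> by one, shifts the base point, and multiplies by \<open>k\<close>. After \<open>n\<close>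
  differences only degree \<open>n\<close> survives.
\<close>

lemma alternating_binomial_sum_pochhammer:
  fixes c :: "'a :: {comm_ring_1, ring_char_0}"
  assumes "k \<le> n"
  shows "(\<Sum>j\<le>n. (-1) ^ j * of_nat (n choose j) * pochhammer (of_nat j + c) k) =
         (if k = n then (-1) ^ n * fact n else 0)"
  using assms
proof (induction n arbitrary: k c)
  case (Suc n)
  show ?case
  proof (cases k)
    case 0
    then show ?thesis
      by (subst alternating_binomial_sum_Suc) simp
  next
    case (Suc k')
    have step: "pochhammer x (Suc k') - pochhammer (x + 1) (Suc k') =
        - of_nat (Suc k') * pochhammer (x + 1) k'" for x :: 'a
      unfolding pochhammer_rec[of x] pochhammer_Suc[of "x + 1"] by (simp add: algebra_simps)
    have "(\<Sum>j\<le>Suc n. (-1) ^ j * of_nat (Suc n choose j) * pochhammer (of_nat j + c) k) =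
        (\<Sum>j\<le>n. (-1) ^ j * of_nat (n choose j) *
            (- of_nat k * pochhammer (of_nat j + (c + 1)) k'))"
      using step[of "of_nat j + c" for j]
      by (subst alternating_binomial_sum_Suc) (simp add: Suc add_ac)
    also have "\<dots> = - of_nat k *
        (\<Sum>j\<le>n. (-1) ^ j * of_nat (n choose j) * pochhammer (of_nat j + (c + 1)) k')"
      by (simp only: sum_distrib_left mult_ac)
    also have "\<dots> = - of_nat k * (if k' = n then (-1) ^ n * fact n else 0)"
      using Suc.prems Suc by (subst Suc.IH) auto
    also have "\<dots> = (if k = Suc n then (-1) ^ Suc n * fact (Suc n) else 0)"
      using Suc by (auto simp: algebra_simps)
    finally show ?thesis .
  qed
qed simp

section \<open>Moments of the Jacobi density\<close>

text \<open>
  The Gamma factors in the denominators of the generalised binomials cancel against the Beta value: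
  the first one completely, the second one up to a quotient that is a Pochhammer symbol. All
  dependence on \<open>j\<close> is then in \<open>n choose j\<close> and that symbol.
\<close>

lemma jacobi_coefficient_Beta:
  fixes \<alpha> \<beta> :: real
  assumes "\<alpha> > -1" "\<beta> > -1" "j \<le> n"
  shows "((real n + \<alpha>) gchoose j) * ((real n + \<beta>) gchoose (n - j)) *
           Beta (real (n - j) + \<alpha> + 1) (real (k + j) + \<beta> + 1) =
         Gamma (real n + \<alpha> + 1) * Gamma (real n + \<beta> + 1) /
           (fact n * Gamma (real n + real k + \<alpha> + \<beta> + 2)) *
         (real (n choose j) * pochhammer (real j + (\<beta> + 1)) k)"
proof -
  have np: "x \<notin> \<int>\<^sub>\<le>\<^sub>0" if "x > 0" for x :: real
    using that by (auto elim!: nonpos_Ints_cases)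
  have *: "(real n + \<alpha>) gchoose j =
      Gamma (real n + \<alpha> + 1) / (fact j * Gamma (real (n - j) + \<alpha> + 1))"
    using assms by (subst gbinomial_Gamma) (auto intro!: np simp: of_nat_diff algebra_simps)
  have **: "(real n + \<beta>) gchoose (n - j) =
      Gamma (real n + \<beta> + 1) / (fact (n - j) * Gamma (real j + \<beta> + 1))"
    using assms by (subst gbinomial_Gamma) (auto intro!: np simp: of_nat_diff algebra_simps)
  have ***: "pochhammer (real j + (\<beta> + 1)) k =
      Gamma (real (k + j) + \<beta> + 1) / Gamma (real j + \<beta> + 1)"
    using assms by (subst pochhammer_Gamma) (auto intro!: np simp: add_ac)
  have ****: "real (n choose j) = fact n / (fact j * fact (n - j))"
    using assms by (simp add: binomial_fact)
  have G: "Gamma (real (n - j) + \<alpha> + 1) \<noteq> 0"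
    using assms by (intro less_imp_neq[THEN not_sym] Gamma_real_pos) auto
  have sum: "(real (n - j) + \<alpha> + 1) + (real (k + j) + \<beta> + 1) = real n + real k + \<alpha> + \<beta> + 2"
    using assms by (simp add: of_nat_diff)
  show ?thesis
    unfolding * ** *** **** Beta_def sum using G by (simp add: field_simps)
qed

text \<open>
  Moments in powers of \<open>1 + t\<close> are the natural ones here, because this factor merges with the weight
  and keeps every summand a single Beta integral.
\<close>

lemma jacobi_shifted_moment:
  fixes \<alpha> \<beta> :: real
  assumes \<alpha>: "\<alpha> > -1" and \<beta>: "\<beta> > -1" and k: "k \<le> n"
  shows "has_bochner_integral lborel
           (\<lambda>t. indicator {-1..1} t *\<^sub>R
              ((1 + t) ^ k * (jacobi_poly n \<alpha> \<beta> t * jacobi_weight \<alpha> \<beta> t)))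
           (if k = n then 2 powr (real n + \<alpha> + \<beta> + 1) *
              Beta (real n + \<alpha> + 1) (real n + \<beta> + 1) else 0)"
proof -
  define c where "c j = ((real n + \<alpha>) gchoose j) * ((real n + \<beta>) gchoose (n - j)) *
      ((-1) ^ (n - j) / 2 ^ n)" for j
  define w where "w j t = (1 - t) powr (real (n - j) + \<alpha>) * (1 + t) powr (real (k + j) + \<beta>)"
    for j and t :: real
  define A where "A = Gamma (real n + \<alpha> + 1) * Gamma (real n + \<beta> + 1) /
      (fact n * Gamma (real n + real k + \<alpha> + \<beta> + 2))"
  \<comment> \<open>\<open>c j * w j t\<close> is the \<open>j\<close>-th summand of the polynomial times \<open>(1 + t) ^ k\<close> and the weight;
     the sign in \<open>c j\<close> comes from writing powers of \<open>t - 1\<close> as powers of \<open>1 - t\<close>.\<close>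
  have "has_bochner_integral lborel
      (\<lambda>t. \<Sum>j\<le>n. c j * (indicator {-1..1} t *\<^sub>R w j t))
      (\<Sum>j\<le>n. c j * (2 powr (real (n - j) + \<alpha> + (real (k + j) + \<beta>) + 1) *
         Beta (real (n - j) + \<alpha> + 1) (real (k + j) + \<beta> + 1)))"
    unfolding w_def using \<alpha> \<beta>
    by (intro has_bochner_integral_sum has_bochner_integral_mult_right
        has_bochner_integral_beta_weight) auto
  also have "(\<lambda>t. \<Sum>j\<le>n. c j * (indicator {-1..1} t *\<^sub>R w j t)) =
      (\<lambda>t. indicator {-1..1} t *\<^sub>R
          ((1 + t) ^ k * (jacobi_poly n \<alpha> \<beta> t * jacobi_weight \<alpha> \<beta> t)))"
  proof
    fix t :: real
    show "(\<Sum>j\<le>n. c j * (indicator {-1..1} t *\<^sub>R w j t)) = indicator {-1..1} t *\<^sub>R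
          ((1 + t) ^ k * (jacobi_poly n \<alpha> \<beta> t * jacobi_weight \<alpha> \<beta> t))"
    proof (cases "t \<in> {-1..1}")
      case True
      \<comment> \<open>At \<open>x = 0\<close>, that is at the endpoints, both sides are \<open>0\<close> since \<open>0 powr a = 0\<close>.\<close>
      have pw: "x powr (real m + e) = x ^ m * x powr e" if "x \<ge> 0" for x e :: real and m
        using that by (cases "x = 0") (auto simp: powr_add powr_realpow)
      have "c j * w j t = ((real n + \<alpha>) gchoose j) * ((real n + \<beta>) gchoose (n - j)) *
          ((t - 1) / 2) ^ (n - j) * ((t + 1) / 2) ^ j *
          ((1 + t) ^ k * jacobi_weight \<alpha> \<beta> t)" if "j \<le> n" for j
      proof -
        have "w j t = (1 - t) ^ (n - j) * (1 + t) ^ (k + j) * jacobi_weight \<alpha> \<beta> t"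
          using True unfolding w_def jacobi_weight_def by (subst (1 2) pw) auto
        moreover have "(2::real) ^ n = 2 ^ (n - j) * 2 ^ j"
          using that by (simp flip: power_add)
        moreover have "(-1) ^ (n - j) * (1 - t) ^ (n - j) = (t - 1) ^ (n - j)"
          by (simp flip: power_mult_distrib)
        ultimately show ?thesis
          by (simp add: c_def power_divide power_add add.commute[of t 1] mult_ac)
      qed
      then show ?thesis
        using True by (simp add: jacobi_poly_def atLeast0AtMost sum_distrib_left
            sum_distrib_right mult_ac)
    qed auto
  qed
  also have "(\<Sum>j\<le>n. c j * (2 powr (real (n - j) + \<alpha> + (real (k + j) + \<beta>) + 1) *
         Beta (real (n - j) + \<alpha> + 1) (real (k + j) + \<beta> + 1))) =
      2 powr (real n + real k + \<alpha> + \<beta> + 1) / 2 ^ n * (-1) ^ n * A *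
      (\<Sum>j\<le>n. (-1) ^ j * of_nat (n choose j) * pochhammer (real j + (\<beta> + 1)) k)"
    unfolding sum_distrib_left
  proof (rule sum.cong)
    fix j assume "j \<in> {..n}"
    then have j: "j \<le> n" by simp
    have e: "real (n - j) + \<alpha> + (real (k + j) + \<beta>) + 1 = real n + real k + \<alpha> + \<beta> + 1"
      using j by (simp add: of_nat_diff)
    have s: "(-1) ^ (n - j) = (-1) ^ n * ((-1) ^ j :: real)"
      using j by (metis (no_types, lifting) Groups.mult_ac(2) left_minus_one_mult_self power_add le_add_diff_inverse)
    have "c j * (2 powr (real (n - j) + \<alpha> + (real (k + j) + \<beta>) + 1) *
         Beta (real (n - j) + \<alpha> + 1) (real (k + j) + \<beta> + 1)) =
        2 powr (real n + real k + \<alpha> + \<beta> + 1) / 2 ^ n * ((-1) ^ n * (-1) ^ j) *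
        (((real n + \<alpha>) gchoose j) * ((real n + \<beta>) gchoose (n - j)) *
           Beta (real (n - j) + \<alpha> + 1) (real (k + j) + \<beta> + 1))"
      unfolding e c_def s by (simp only: times_divide_eq_left times_divide_eq_right mult_ac)
    also have "\<dots> = 2 powr (real n + real k + \<alpha> + \<beta> + 1) / 2 ^ n * (-1) ^ n * A *
       ((-1) ^ j * of_nat (n choose j) * pochhammer (real j + (\<beta> + 1)) k)"
      unfolding jacobi_coefficient_Beta[OF \<alpha> \<beta> j] A_def[symmetric] by (simp only: mult_ac)
    finally show "c j * (2 powr (real (n - j) + \<alpha> + (real (k + j) + \<beta>) + 1) *
         Beta (real (n - j) + \<alpha> + 1) (real (k + j) + \<beta> + 1)) =
        2 powr (real n + real k + \<alpha> + \<beta> + 1) / 2 ^ n * (-1) ^ n * A *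
       ((-1) ^ j * of_nat (n choose j) * pochhammer (real j + (\<beta> + 1)) k)" .
  qed simp
  also have "\<dots> = (if k = n then 2 powr (real n + \<alpha> + \<beta> + 1) *
      Beta (real n + \<alpha> + 1) (real n + \<beta> + 1) else 0)"
  proof (cases "k = n")
    case True
    have "2 powr (real n + real n + \<alpha> + \<beta> + 1) = 2 powr real n * (2::real) powr (real n + \<alpha> + \<beta> + 1)"
      by (simp flip: powr_add add: add_ac)
    moreover have "2 powr real n = (2::real) ^ n"
      by (simp add: powr_realpow)
    moreover have "A = Beta (real n + \<alpha> + 1) (real n + \<beta> + 1) / fact n"
    proof -
      have arg: "real n + real k + \<alpha> + \<beta> + 2 = (real n + \<alpha> + 1) + (real n + \<beta> + 1)"
        using True by simp
      show ?thesis
        unfolding A_def Beta_def arg by simp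
    qed
    ultimately show ?thesis
      unfolding alternating_binomial_sum_pochhammer[OF k]
      using True by (cases "even n") simp_all
  next
    case False
    then show ?thesis
      unfolding alternating_binomial_sum_pochhammer[OF k] by simp
  qed
  finally show ?thesis .
qed

lemma jacobi_density_shifted_moment:
  fixes \<alpha> \<beta> :: real
  assumes \<alpha>: "\<alpha> > -1" and \<beta>: "\<beta> > -1" and k: "k \<le> n"
  shows "has_bochner_integral lborel
           (\<lambda>t. indicator {-1..1} t *\<^sub>R ((1 + t) ^ k * jacobi_density n \<alpha> \<beta> t))
           (if k = n then fact n else 0)"
proof -
  define K where "K = 2 powr (- (real n + \<alpha> + \<beta> + 1)) * fact n /
      Beta (real n + \<alpha> + 1) (real n + \<beta> + 1)"
  have inv: "2 powr (- e) * 2 powr e = (1 :: real)" for e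
    by (simp flip: powr_add)
  have "Beta (real n + \<alpha> + 1) (real n + \<beta> + 1) > 0"
    unfolding Beta_def using \<alpha> \<beta> by (intro divide_pos_pos mult_pos_pos Gamma_real_pos) auto
  then have "K * (2 powr (real n + \<alpha> + \<beta> + 1) *
      Beta (real n + \<alpha> + 1) (real n + \<beta> + 1)) = fact n"
    using inv[of "real n + \<alpha> + \<beta> + 1"] by (simp only: K_def) (simp add: field_simps)
  then have "K * (if k = n then 2 powr (real n + \<alpha> + \<beta> + 1) *
      Beta (real n + \<alpha> + 1) (real n + \<beta> + 1) else 0) = (if k = n then fact n else 0)"
    by simp
  moreover have "indicator {-1..1} t *\<^sub>R ((1 + t) ^ k * jacobi_density n \<alpha> \<beta> t) =
      K * (indicator {-1..1} t *\<^sub>R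
        ((1 + t) ^ k * (jacobi_poly n \<alpha> \<beta> t * jacobi_weight \<alpha> \<beta> t)))" for t
    by (simp add: jacobi_density_def K_def)
  ultimately show ?thesis
    using has_bochner_integral_mult_right[OF jacobi_shifted_moment[OF \<alpha> \<beta> k], of K]
    by (simp only:)
qed

text \<open>
  Expanding \<open>t ^ k = ((1 + t) - 1) ^ k\<close> leaves only the term \<open>(1 + t) ^ n\<close>, which occurs for \<open>k = n\<close>
  alone and has coefficient \<open>1\<close> there.
\<close>

lemma jacobi_density_moment:
  fixes \<alpha> \<beta> :: real
  assumes \<alpha>: "\<alpha> > -1" and \<beta>: "\<beta> > -1" and k: "k \<le> n"
  shows "(LINT t:{-1..1}|lborel. t ^ k * jacobi_density n \<alpha> \<beta> t) =
         (if k = n then fact n else 0)"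
proof -
  have "t ^ k = (\<Sum>i\<le>k. real (k choose i) * (-1) ^ (k - i) * (1 + t) ^ i)" for t :: real
    using binomial_ring[of "1 + t" "-1" k] by (simp add: mult_ac)
  then have eq: "indicator {-1..1} t *\<^sub>R (t ^ k * jacobi_density n \<alpha> \<beta> t) =
      (\<Sum>i\<le>k. real (k choose i) * (-1) ^ (k - i) *
         (indicator {-1..1} t *\<^sub>R ((1 + t) ^ i * jacobi_density n \<alpha> \<beta> t)))" for t
    by (simp add: sum_distrib_left sum_distrib_right mult_ac)
  have "has_bochner_integral lborel
      (\<lambda>t. indicator {-1..1} t *\<^sub>R (t ^ k * jacobi_density n \<alpha> \<beta> t))
      (\<Sum>i\<le>k. real (k choose i) * (-1) ^ (k - i) * (if i = n then fact n else 0))"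
    unfolding eq using k
    by (intro has_bochner_integral_sum has_bochner_integral_mult_right
        jacobi_density_shifted_moment[OF \<alpha> \<beta>]) auto
  also have "(\<Sum>i\<le>k. real (k choose i) * (-1) ^ (k - i) * (if i = n then fact n else 0)) =
      (\<Sum>i\<le>k. if i = n then (if k = n then fact n else 0) else 0 :: real)"
    using k by (intro sum.cong) auto
  also have "\<dots> = (if k = n then fact n else 0)"
    by (subst sum.delta) auto
  finally show ?thesis
    unfolding set_lebesgue_integral_def by (rule has_bochner_integral_integral_eq)
qed

text \<open>
  The density may be unbounded at the endpoints, but it is integrable by the moment of order \<open>0\<close>,
  and this survives multiplication by a bounded measurable function.
\<close>

lemma jacobi_density_mult_integrable:
  fixes \<alpha> \<beta> :: real
  assumes \<alpha>: "\<alpha> > -1" and \<beta>: "\<beta> > -1" and g: "continuous_on {-1..1} g"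
  shows "set_integrable lborel {-1..1} (\<lambda>t. jacobi_density n \<alpha> \<beta> t * g t)"
proof -
  have "bounded (g ` {-1..1})"
    using g compact_continuous_image compact_imp_bounded by blast
  then obtain C where "\<forall>y\<in>g ` {-1..1}. norm y \<le> C"
    unfolding bounded_iff by blast
  then have C: "\<bar>g t\<bar> \<le> C" if "t \<in> {-1..1}" for t
    using that by auto
  have int: "set_integrable lborel {-1..1} (jacobi_density n \<alpha> \<beta>)"
    using jacobi_density_shifted_moment[OF \<alpha> \<beta>, of 0 n]
    by (simp add: set_integrable_def has_bochner_integral_iff)
  have meas: "(\<lambda>t. indicator {-1..1} t *\<^sub>R g t) \<in> borel_measurable borel"
    using g by (intro borel_measurable_continuous_on_indicator) auto
  show ?thesis
    unfolding set_integrable_def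
  proof (rule Bochner_Integration.integrable_bound)
    show "integrable lborel (\<lambda>t. C * (indicator {-1..1} t *\<^sub>R jacobi_density n \<alpha> \<beta> t))"
      using int unfolding set_integrable_def by (rule integrable_mult_right)
    have "(\<lambda>t. (indicator {-1..1} t *\<^sub>R jacobi_density n \<alpha> \<beta> t) * (indicator {-1..1} t *\<^sub>R g t))
        \<in> borel_measurable lborel"
      using int meas unfolding set_integrable_def by (intro borel_measurable_times) auto
    also have "(\<lambda>t. (indicator {-1..1} t *\<^sub>R jacobi_density n \<alpha> \<beta> t) * (indicator {-1..1} t *\<^sub>R g t)) =
        (\<lambda>t. indicator {-1..1} t *\<^sub>R (jacobi_density n \<alpha> \<beta> t * g t))"
      by (auto simp: indicator_def)
    finally show "(\<lambda>t. indicator {-1..1} t *\<^sub>R (jacobi_density n \<alpha> \<beta> t * g t))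
        \<in> borel_measurable lborel" .
    show "AE t in lborel. norm (indicator {-1..1} t *\<^sub>R (jacobi_density n \<alpha> \<beta> t * g t))
        \<le> norm (C * (indicator {-1..1} t *\<^sub>R jacobi_density n \<alpha> \<beta> t))"
    proof (rule AE_I2)
      fix t
      show "norm (indicator {-1..1} t *\<^sub>R (jacobi_density n \<alpha> \<beta> t * g t))
        \<le> norm (C * (indicator {-1..1} t *\<^sub>R jacobi_density n \<alpha> \<beta> t))"
      proof (cases "t \<in> {-1..1}")
        case True
        then have "\<bar>g t\<bar> \<le> \<bar>C\<bar>" using C by fastforce
        with True show ?thesis
          by (simp add: abs_mult mult.commute mult_right_mono)
      qed simp
    qed
  qed
qed

text \<open>
  Reflecting the summation index, \<open>j \<mapsto> n - j\<close>, exchanges the two endpoints and with them the two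
  parameters.
\<close>

lemma jacobi_density_reflect: "jacobi_density n \<alpha> \<beta> (- t) = (-1) ^ n * jacobi_density n \<beta> \<alpha> t"
proof -
  have "jacobi_poly n \<alpha> \<beta> (- t) = (-1) ^ n * jacobi_poly n \<beta> \<alpha> t"
    unfolding jacobi_poly_def atLeast0AtMost sum_distrib_left
  proof (rule sum.reindex_bij_witness[of _ "\<lambda>j. n - j" "\<lambda>j. n - j"])
    fix j assume "j \<in> {..n}"
    then have j: "j \<le> n" by simp
    have 1: "((- t - 1) / 2) ^ (n - j) = (-1) ^ (n - j) * ((t + 1) / 2) ^ (n - j)"
      unfolding power_mult_distrib [symmetric] by (rule arg_cong[of _ _ "\<lambda>x. x ^ (n - j)"]) simp
    have 2: "((- t + 1) / 2) ^ j = (-1) ^ j * ((t - 1) / 2) ^ j"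
      unfolding power_mult_distrib [symmetric] by (rule arg_cong[of _ _ "\<lambda>x. x ^ j"]) simp
    have 3: "(-1) ^ n = (-1) ^ (n - j) * ((-1) ^ j :: real)"
      using j by (simp flip: power_add)
    show "(-1) ^ n * (((real n + \<beta>) gchoose (n - j)) * ((real n + \<alpha>) gchoose (n - (n - j))) *
        ((t - 1) / 2) ^ (n - (n - j)) * ((t + 1) / 2) ^ (n - j)) =
      ((real n + \<alpha>) gchoose j) * ((real n + \<beta>) gchoose (n - j)) *
        ((- t - 1) / 2) ^ (n - j) * ((- t + 1) / 2) ^ j"
      unfolding 1 2 3 using j by simp
  qed auto
  moreover have "jacobi_weight \<alpha> \<beta> (- t) = jacobi_weight \<beta> \<alpha> t"
    by (simp add: jacobi_weight_def mult.commute)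
  ultimately show ?thesis
    unfolding jacobi_density_def Beta_commute[of "real n + \<alpha> + 1"] by (simp add: add_ac)
qed

text \<open>
  The integrand is odd: \<open>t ^ Suc n\<close> and the density have opposite parities.
\<close>

lemma ultraspherical_density_moment_Suc:
  "(LINT t:{-1..1}|lborel. t ^ Suc n * jacobi_density n \<alpha> \<alpha> t) = 0"
proof -
  have "(- t) ^ Suc n * jacobi_density n \<alpha> \<alpha> (- t) = - (t ^ Suc n * jacobi_density n \<alpha> \<alpha> t)" for t
    unfolding jacobi_density_reflect power_minus[of t]
    by simp
  moreover have "{t::real. - t \<in> {-1..1}} = {-1..1}" by auto
  ultimately have "(LINT t:{-1..1}|lborel. t ^ Suc n * jacobi_density n \<alpha> \<alpha> t) =
      (LINT t:{-1..1}|lborel. - (t ^ Suc n * jacobi_density n \<alpha> \<alpha> t))"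
    by (subst set_integral_reflect) (simp only:)
  then show ?thesis
    by (simp add: set_lebesgue_integral_def)
qed

section \<open>Taylor expansion\<close>

lemma C_k_on_continuous_deriv:
  assumes "C_k_on m f S" "j \<le> m"
  shows "continuous_on S ((deriv ^^ j) f)"
proof (cases "j = m")
  case False
  with assms have "\<forall>x\<in>S. (deriv ^^ j) f field_differentiable at x"
    by (auto simp: C_k_on_def)
  then show ?thesis
    by (meson continuous_at_imp_continuous_on field_differentiable_imp_continuous_at)
qed (use assms in \<open>auto simp: C_k_on_def\<close>)

lemma C_k_on_subset: "C_k_on m f S \<Longrightarrow> T \<subseteq> S \<Longrightarrow> C_k_on m f T"
  unfolding C_k_on_def by (meson continuous_on_subset subsetD)

lemma C_k_on_taylor_remainder:
  assumes f: "C_k_on m f {x - h..x + h}" and m: "m > 0" and h: "h > 0"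
    and M: "\<And>y. y \<in> {x - h..x + h} \<Longrightarrow> \<bar>(deriv ^^ m) f y\<bar> \<le> M"
    and t: "t \<in> {-1..1}"
  shows "\<bar>f (x + h * t) - (\<Sum>k<m. (deriv ^^ k) f x / fact k * (h * t) ^ k)\<bar> \<le>
         M / fact m * \<bar>h * t\<bar> ^ m"
proof (cases "t = 0")
  case True
  then show ?thesis
    using m by (simp add: power_0_left if_distrib cong: if_cong)
next
  case False
  have "-h \<le> h * t" "h * t \<le> h"
    using t h mult_left_mono[of "-1" t h] mult_left_mono[of t 1 h] by auto
  moreover have "\<forall>j s. j < m \<and> x - h \<le> s \<and> s \<le> x + h \<longrightarrow>
      DERIV ((deriv ^^ j) f) s :> (deriv ^^ Suc j) f s"
    using f by (auto simp: C_k_on_def field_differentiable_derivI)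
  ultimately obtain s where s: "if x + h * t < x then x + h * t < s \<and> s < x else x < s \<and> s < x + h * t"
    and eq: "f (x + h * t) = (\<Sum>k<m. (deriv ^^ k) f x / fact k * (x + h * t - x) ^ k) +
        (deriv ^^ m) f s / fact m * (x + h * t - x) ^ m"
    using Taylor[of m "\<lambda>k. (deriv ^^ k) f" f "x - h" "x + h" x "x + h * t"] m h False by auto
  have "s \<in> {x - h..x + h}"
    using s \<open>-h \<le> h * t\<close> \<open>h * t \<le> h\<close> by (auto split: if_splits)
  from M[OF this] show ?thesis
    unfolding eq by (simp add: abs_mult power_abs divide_right_mono mult_right_mono)
qed

section \<open>The error of the estimator\<close>

text \<open>
  The Taylor polynomial \<open>T\<close> of degree \<open>n + 1\<close> contributes exactly the \<open>n\<close>-th derivative, so that only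
  the remainder \<open>R\<close> enters the error. Regularity and the bound \<open>M\<close> are asked for on \<open>[x - h, x + h]\<close>
  alone, so that both the local and the uniform estimate follow.
\<close>

lemma ultraspherical_estimator_error:
  assumes \<alpha>: "\<alpha> > -1" and h: "h > 0"
    and f: "C_k_on (n + 2) f {x - h..x + h}"
    and M: "\<And>y. y \<in> {x - h..x + h} \<Longrightarrow> \<bar>(deriv ^^ (n + 2)) f y\<bar> \<le> M"
  shows "\<bar>minimal_estimator n h \<alpha> \<alpha> f x - (deriv ^^ n) f x\<bar> \<le>
         M / fact (n + 2) * (LINT t:{-1..1}|lborel. \<bar>t ^ (n + 2) * jacobi_density n \<alpha> \<alpha> t\<bar>) * h ^ 2"
proof -
  define \<rho> where "\<rho> = jacobi_density n \<alpha> \<alpha>"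
  define T where "T t = (\<Sum>k<n+2. (deriv ^^ k) f x / fact k * (h * t) ^ k)" for t
  define R where "R t = f (x + h * t) - T t" for t
  have int: "set_integrable lborel {-1..1} (\<lambda>t. \<rho> t * g t)" if "continuous_on {-1..1} g" for g
    unfolding \<rho>_def by (rule jacobi_density_mult_integrable[OF \<alpha> \<alpha> that])
  have range: "x + h * t \<in> {x - h..x + h}" if "t \<in> {-1..1}" for t
    using that h mult_left_mono[of "-1" t h] mult_left_mono[of t 1 h] by auto
  have "continuous_on {x - h..x + h} f"
    using C_k_on_continuous_deriv[OF f, of 0] by simp
  then have cont_f: "continuous_on {-1..1} (\<lambda>t. f (x + h * t))"
    by (rule continuous_on_compose2) (use range in \<open>auto intro!: continuous_intros\<close>)
  have cont_T: "continuous_on {-1..1} T"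
    unfolding T_def by (intro continuous_intros)
  have cont_R: "continuous_on {-1..1} R"
    unfolding R_def by (intro continuous_intros cont_f cont_T)

  \<comment> \<open>Symmetry of the density covers the order \<open>n + 1\<close>; without it the error would be of order \<open>h\<close>.\<close>
  have moment: "(LINT t:{-1..1}|lborel. \<rho> t * t ^ k) = (if k = n then fact n else 0)"
    if "k < n + 2" for k
  proof (cases "k = Suc n")
    case True
    then show ?thesis
      using ultraspherical_density_moment_Suc[of n \<alpha>] by (simp add: \<rho>_def mult.commute)
  next
    case False
    then show ?thesis
      using jacobi_density_moment[OF \<alpha> \<alpha>, of k n] that by (simp add: \<rho>_def mult.commute)
  qed
  have "\<rho> t * T t = (\<Sum>k<n+2. ((deriv ^^ k) f x / fact k * h ^ k) * (\<rho> t * t ^ k))" for t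
    unfolding T_def sum_distrib_left by (intro sum.cong refl) (simp add: power_mult_distrib)
  then have "(LINT t:{-1..1}|lborel. \<rho> t * T t) =
      (LINT t:{-1..1}|lborel. (\<Sum>k<n+2. ((deriv ^^ k) f x / fact k * h ^ k) * (\<rho> t * t ^ k)))"
    by (simp only:)
  also have "\<dots> = (\<Sum>k<n+2. LINT t:{-1..1}|lborel. (deriv ^^ k) f x / fact k * h ^ k * (\<rho> t * t ^ k))"
    unfolding set_lebesgue_integral_def scaleR_sum_right
    by (rule Bochner_Integration.integral_sum)
       (fold set_integrable_def, intro set_integrable_mult_right int continuous_intros)
  also have "\<dots> = (\<Sum>k<n+2. (deriv ^^ k) f x / fact k * h ^ k * (LINT t:{-1..1}|lborel. \<rho> t * t ^ k))"
    by (simp only: set_integral_mult_right)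
  also have "\<dots> = (\<Sum>k<n+2. if k = n then h ^ n * (deriv ^^ n) f x else 0)"
    using moment by (intro sum.cong) auto
  also have "\<dots> = h ^ n * (deriv ^^ n) f x"
    by (subst sum.delta) auto
  finally have T: "(LINT t:{-1..1}|lborel. \<rho> t * T t) = h ^ n * (deriv ^^ n) f x" .
  have "(LINT t:{-1..1}|lborel. \<rho> t * f (x + h * t)) =
      (LINT t:{-1..1}|lborel. \<rho> t * T t + \<rho> t * R t)"
    by (simp add: R_def algebra_simps)
  also have "\<dots> = h ^ n * (deriv ^^ n) f x + (LINT t:{-1..1}|lborel. \<rho> t * R t)"
    by (subst set_integral_add) (auto intro!: int cont_T cont_R simp: T)
  finally have "minimal_estimator n h \<alpha> \<alpha> f x - (deriv ^^ n) f x =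
      (LINT t:{-1..1}|lborel. \<rho> t * R t) / h ^ n"
    using h by (simp add: minimal_estimator_def \<rho>_def field_simps)
  then have err: "\<bar>minimal_estimator n h \<alpha> \<alpha> f x - (deriv ^^ n) f x\<bar> =
      \<bar>LINT t:{-1..1}|lborel. \<rho> t * R t\<bar> / h ^ n"
    using h by simp
  have "\<bar>LINT t:{-1..1}|lborel. \<rho> t * R t\<bar> \<le> (LINT t:{-1..1}|lborel. \<bar>\<rho> t * R t\<bar>)"
    using set_integral_norm_bound[OF int[OF cont_R]] by simp
  also have "\<dots> \<le> (LINT t:{-1..1}|lborel. M / fact (n + 2) * h ^ (n + 2) * \<bar>\<rho> t * t ^ (n + 2)\<bar>)"
  proof (rule set_integral_mono)
    show "set_integrable lborel {-1..1} (\<lambda>t. \<bar>\<rho> t * R t\<bar>)"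
      by (intro set_integrable_abs int cont_R)
    show "set_integrable lborel {-1..1} (\<lambda>t. M / fact (n + 2) * h ^ (n + 2) * \<bar>\<rho> t * t ^ (n + 2)\<bar>)"
      by (intro set_integrable_mult_right set_integrable_abs int continuous_intros)
    fix t :: real assume t: "t \<in> {-1..1}"
    have "\<bar>R t\<bar> \<le> M / fact (n + 2) * \<bar>h * t\<bar> ^ (n + 2)"
      unfolding R_def T_def by (rule C_k_on_taylor_remainder[OF f _ h M t]) auto
    then have "\<bar>\<rho> t\<bar> * \<bar>R t\<bar> \<le> \<bar>\<rho> t\<bar> * (M / fact (n + 2) * \<bar>h * t\<bar> ^ (n + 2))"
      by (rule mult_left_mono) simp
    also have "\<dots> = M / fact (n + 2) * h ^ (n + 2) * \<bar>\<rho> t * t ^ (n + 2)\<bar>"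
      using h by (simp only: abs_mult power_mult_distrib power_abs abs_of_pos mult_ac)
    finally show "\<bar>\<rho> t * R t\<bar> \<le> M / fact (n + 2) * h ^ (n + 2) * \<bar>\<rho> t * t ^ (n + 2)\<bar>"
      by (simp add: abs_mult)
  qed
  also have "\<dots> = M / fact (n + 2) * (LINT t:{-1..1}|lborel. \<bar>t ^ (n + 2) * \<rho> t\<bar>) * h ^ 2 * h ^ n"
    by (subst set_integral_mult_right) (simp only: power_add mult_ac)
  finally show ?thesis
    unfolding err \<rho>_def[symmetric] using h by (subst pos_divide_le_eq) auto
qed

theorem corollary4:
  fixes I :: "real set" and n :: nat and \<alpha> :: real and f :: "real \<Rightarrow> real"
  assumes "open I" and "is_interval I"
    and "\<alpha> > -1"
    and "C_k_on (n + 2) f I"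
  shows "(\<forall>x\<in>I. (\<lambda>h. minimal_estimator n h \<alpha> \<alpha> f x - (deriv ^^ n) f x)
             \<in> O[at 0 within {h. h > 0 \<and> x \<in> inner_domain I h}](\<lambda>h. h ^ 2)) \<and>
         (\<forall>M>0. (\<forall>x\<in>I. \<bar>(deriv ^^ (n + 2)) f x\<bar> \<le> M) \<longrightarrow>
            (\<forall>h>0. sup_norm_on (inner_domain I h)
                      (\<lambda>x. minimal_estimator n h \<alpha> \<alpha> f x - (deriv ^^ n) f x)
                    \<le> ennreal (M / fact (n + 2) *
                         (LINT t:{-1..1}|lborel. \<bar>t ^ (n + 2) * jacobi_density n \<alpha> \<alpha> t\<bar>) * h ^ 2)))"
proof (intro conjI ballI allI impI)
  fix x assume "x \<in> I"
  then obtain d where d: "d > 0" "cball x d \<subseteq> I"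
    using \<open>open I\<close> open_contains_cball by blast
  have "cball x d = {x - d..x + d}"
    by (auto simp: dist_real_def)
  with d have sub: "{x - d..x + d} \<subseteq> I" by simp
  then have "continuous_on {x - d..x + d} ((deriv ^^ (n + 2)) f)"
    using assms(4) by (meson C_k_on_continuous_deriv continuous_on_subset order_refl)
  then have "bounded ((deriv ^^ (n + 2)) f ` {x - d..x + d})"
    using compact_continuous_image compact_imp_bounded by blast
  then obtain M where "\<forall>z\<in>(deriv ^^ (n + 2)) f ` {x - d..x + d}. norm z \<le> M"
    unfolding bounded_iff by blast
  then have M: "\<bar>(deriv ^^ (n + 2)) f y\<bar> \<le> M" if "y \<in> {x - d..x + d}" for y
    using that by auto
  define K where "K = M / fact (n + 2) *
      (LINT t:{-1..1}|lborel. \<bar>t ^ (n + 2) * jacobi_density n \<alpha> \<alpha> t\<bar>)"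
  have "\<bar>minimal_estimator n h \<alpha> \<alpha> f x - (deriv ^^ n) f x\<bar> \<le> K * h ^ 2" if "0 < h" "h < d" for h
  proof -
    have "{x - h..x + h} \<subseteq> {x - d..x + d}" using that by auto
    with sub have "C_k_on (n + 2) f {x - h..x + h}"
      by (intro C_k_on_subset[OF assms(4)]) blast
    then show ?thesis
      unfolding K_def by (rule ultraspherical_estimator_error[OF \<open>\<alpha> > -1\<close> \<open>0 < h\<close>])
        (use that in \<open>intro M, auto\<close>)
  qed
  moreover have "\<forall>\<^sub>F h in at 0 within {h. h > 0 \<and> x \<in> inner_domain I h}. 0 < h \<and> h < d"
    unfolding eventually_at using \<open>d > 0\<close> by (intro exI[of _ d]) (auto simp: dist_real_def)
  ultimately show "(\<lambda>h. minimal_estimator n h \<alpha> \<alpha> f x - (deriv ^^ n) f x)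
      \<in> O[at 0 within {h. h > 0 \<and> x \<in> inner_domain I h}](\<lambda>h. h ^ 2)"
    by (intro bigoI[of _ K]) (auto elim!: eventually_mono)
next
  fix M h :: real
  assume M: "\<forall>x\<in>I. \<bar>(deriv ^^ (n + 2)) f x\<bar> \<le> M" and h: "h > 0"
  show "sup_norm_on (inner_domain I h)
          (\<lambda>x. minimal_estimator n h \<alpha> \<alpha> f x - (deriv ^^ n) f x)
        \<le> ennreal (M / fact (n + 2) *
             (LINT t:{-1..1}|lborel. \<bar>t ^ (n + 2) * jacobi_density n \<alpha> \<alpha> t\<bar>) * h ^ 2)"
    unfolding sup_norm_on_def
  proof (intro SUP_least ennreal_leI)
    fix x assume "x \<in> inner_domain I h"
    then have sub: "{x - h..x + h} \<subseteq> I" by (simp add: inner_domain_def)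
    show "\<bar>minimal_estimator n h \<alpha> \<alpha> f x - (deriv ^^ n) f x\<bar> \<le> M / fact (n + 2) *
        (LINT t:{-1..1}|lborel. \<bar>t ^ (n + 2) * jacobi_density n \<alpha> \<alpha> t\<bar>) * h ^ 2"
      using sub M by (intro ultraspherical_estimator_error assms h C_k_on_subset[OF assms(4)]) auto
  qed
qed

end
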